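(* Let $\mathcal{H}$ be a hypergraph. Then $$hk(\mathcal{H}) \geq \min_{v\in V(\mathcal{H})} \deg_{\mathcal{H}}(v).$$
   Context: A hypergraph $\mathcal{H}$ consists of a finite nonempty vertex set $V(\mathcal{H})$ and a set $E(\mathcal{H})$ of subsets of $V(\mathcal{H})$ called hyperedges. All hypergraphs may have isolated vertices (vertices in no hyperedge) but have no loops, so every hyperedge has at least two vertices. The degree $\deg_{\mathcal{H}}(v)$ of a vertex $v$ is the number of hyperedges containing $v$. For a finite set $I$ disjoint from $V(\mathcal{H})$, $\mathcal{H}\cup I$ is the hypergraph with vertex set $V(\mathcal{H})\cup I$ and hyperedge set $E(\mathcal{H})$. For a digraph $D$ and a vertex $v$, the in-neighborhood is $N_D^-(v)=\{x : (x,v)\in A(D)\}$. The competition hypergraph $C\mathcal{H}(D)$ of $D$ is the hypergraph with vertex set $V(D)$ in which $e\subseteq V(D)$ is a hyperedge if and only if $|e|\ge 2$ and $e=N_D^-(v)$ for some vertex $v$ of $D$. The hypercompetition number $hk(\mathcal{H})$ is the smallest integer $k\ge 0$ such that $\mathcal{H}\cup I$, where $I$ is a set of $k$ new isolated vertices, is the competition hypergraph of some acyclic digraph (one with no directed cycles, in particular no loops). *)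

theory Defs
  imports "Graph_Theory.Pair_Digraph"
begin

record 'a pre_hypergraph =
  hverts :: "'a set"
  hedges :: "'a set set"

locale hypergraph =
  fixes H :: "'a pre_hypergraph"
  assumes finite_hverts: "finite (hverts H)"
    and hverts_nonempty: "hverts H \<noteq> {}"
    and hedge_subset: "e \<in> hedges H \<Longrightarrow> e \<subseteq> hverts H"
    and hedge_card: "e \<in> hedges H \<Longrightarrow> 2 \<le> card e"

definition hdegree :: "'a pre_hypergraph \<Rightarrow> 'a \<Rightarrow> nat" where
  "hdegree H v = card {e \<in> hedges H. v \<in> e}"

text \<open>Meant for a finite \<open>I\<close> disjoint from the vertex set.\<close>

definition add_isolated :: "'a pre_hypergraph \<Rightarrow> 'a set \<Rightarrow> 'a pre_hypergraph" where
  "add_isolated H I = \<lparr> hverts = hverts H \<union> I, hedges = hedges H \<rparr>"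

definition map_hypergraph :: "('a \<Rightarrow> 'b) \<Rightarrow> 'a pre_hypergraph \<Rightarrow> 'b pre_hypergraph" where
  "map_hypergraph f H = \<lparr> hverts = f ` hverts H, hedges = (`) f ` hedges H \<rparr>"

definition in_nbhd :: "'a pair_pre_digraph \<Rightarrow> 'a \<Rightarrow> 'a set" where
  "in_nbhd D v = {x. (x, v) \<in> parcs D}"

definition competition_hypergraph :: "'a pair_pre_digraph \<Rightarrow> 'a pre_hypergraph" where
  "competition_hypergraph D =
    \<lparr> hverts = pverts D,
      hedges = {e. e \<subseteq> pverts D \<and> 2 \<le> card e \<and> (\<exists>v\<in>pverts D. e = in_nbhd D v)} \<rparr>"

text \<open>
  Digraphs are finite, without parallel arcs. The locale \<open>pair_fin_digraph\<close> permits loops, but a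
  loop is a cycle in the sense of \<open>pre_digraph.cycle\<close>, so acyclic digraphs have none.
\<close>

definition acyclic_digraph :: "'a pair_pre_digraph \<Rightarrow> bool" where
  "acyclic_digraph D \<longleftrightarrow> pair_fin_digraph D \<and> \<not> (\<exists>p. pre_digraph.cycle (with_proj D) p)"

text \<open>
  The type \<open>'a\<close> may have no elements outside \<open>hverts H\<close>. New vertices are therefore
  taken from \<open>'a + nat\<close>, which contains a copy of \<open>H\<close> (via \<open>Inl\<close>) and infinitely many further
  elements. The lemma \<open>hypercompetition_number_witness\<close> below shows that the minimum is taken over
  a nonempty set.
\<close>

definition hypercompetition_number :: "'a pre_hypergraph \<Rightarrow> nat" where
  "hypercompetition_number H =
    (LEAST k. \<exists>(I :: ('a + nat) set) D.
       finite I \<and> card I = k \<and> I \<inter> hverts (map_hypergraph Inl H) = {} \<and>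
       acyclic_digraph D \<and>
       competition_hypergraph D = add_isolated (map_hypergraph Inl H) I)"

lemma acyclic_digraph_iff_acyclic:
  "acyclic_digraph D \<longleftrightarrow> pair_fin_digraph D \<and> acyclic (parcs D)"
proof (cases "pair_fin_digraph D")
  case True
  then interpret pair_fin_digraph D .
  have "(\<exists>p. cycle p) \<longleftrightarrow> (\<exists>u. (u, u) \<in> (parcs D)\<^sup>+)"
    using closed_w_imp_cycle unfolding reachable1_awalk closed_w_def cycle_def by blast
  then show ?thesis
    by (simp add: acyclic_digraph_def acyclic_def True)
qed (simp add: acyclic_digraph_def)

lemma hypercompetition_number_witness:
  fixes H :: "'a pre_hypergraph"
  assumes "hypergraph H"
  shows "\<exists>(I :: ('a + nat) set) D.
    finite I \<and> card I = hypercompetition_number H \<and> I \<inter> hverts (map_hypergraph Inl H) = {} \<and>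
    acyclic_digraph D \<and> competition_hypergraph D = add_isolated (map_hypergraph Inl H) I"
proof -
  interpret hypergraph H by fact
  have finE: "finite (hedges H)"
    by (rule finite_subset[of _ "Pow (hverts H)"]) (auto simp: finite_hverts dest: hedge_subset)
  then obtain f :: "'a set \<Rightarrow> nat" where inj: "inj_on f (hedges H)"
    using finite_imp_inj_to_nat_seg[OF finE] by auto
  define I :: "('a + nat) set" where "I = (\<lambda>e. Inr (f e)) ` hedges H"
  define A :: "('a + nat) rel" where "A = {(Inl x, Inr (f e)) | x e. e \<in> hedges H \<and> x \<in> e}"
  define D where "D = \<lparr> pverts = Inl ` hverts H \<union> I, parcs = A \<rparr>"
  have finI: "finite I" using finE by (simp add: I_def)
  have disj: "I \<inter> hverts (map_hypergraph Inl H) = {}"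
    by (auto simp: I_def map_hypergraph_def)
  have sub: "A \<subseteq> pverts D \<times> pverts D"
    unfolding A_def D_def I_def by (fastforce dest: hedge_subset)
  have "finite (pverts D)" using finite_hverts finI by (simp add: D_def)
  then have "finite A" using sub by (simp add: finite_subset[OF sub])
  with sub \<open>finite (pverts D)\<close> have fin: "pair_fin_digraph D"
    by unfold_locales (auto simp: D_def)
  have "(x, y) \<in> A\<^sup>+ \<Longrightarrow> (x, y) \<in> A" for x y
    by (induction rule: trancl_induct) (auto simp: A_def)
  then have "acyclic A" by (auto simp: acyclic_def A_def)
  with fin have acyc: "acyclic_digraph D"
    by (simp add: acyclic_digraph_iff_acyclic D_def)
  have nb1: "in_nbhd D (Inr (f e)) = Inl ` e" if "e \<in> hedges H" for e
    using that by (auto simp: in_nbhd_def D_def A_def inj_on_eq_iff[OF inj])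
  have nb2: "in_nbhd D (Inl x) = {}" for x
    by (auto simp: in_nbhd_def D_def A_def)
  have edges: "{e. e \<subseteq> pverts D \<and> 2 \<le> card e \<and> (\<exists>v\<in>pverts D. e = in_nbhd D v)}
      = (`) Inl ` hedges H" (is "?L = ?R")
  proof
    show "?L \<subseteq> ?R"
    proof
      fix e' assume "e' \<in> ?L"
      then obtain v where v: "v \<in> pverts D" "e' = in_nbhd D v" "2 \<le> card e'"
        by blast
      from v(1) consider x where "v = Inl x" | e where "e \<in> hedges H" "v = Inr (f e)"
        unfolding D_def I_def by auto
      then show "e' \<in> ?R"
        by cases (use v nb1 nb2 in simp_all)
    qed
    show "?R \<subseteq> ?L"
    proof
      fix e' :: "('a + nat) set" assume "e' \<in> ?R"
      then obtain e where e: "e \<in> hedges H" "e' = Inl ` e" by blast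
      have "Inr (f e) \<in> pverts D" "e' \<subseteq> pverts D"
        using e hedge_subset[OF e(1)] unfolding D_def I_def by auto
      moreover have "2 \<le> card e'" using e hedge_card[OF e(1)] by (simp add: card_image)
      moreover have "e' = in_nbhd D (Inr (f e))" using nb1[OF e(1)] e(2) by simp
      ultimately show "e' \<in> ?L" by blast
    qed
  qed
  have "pverts D = Inl ` hverts H \<union> I" by (simp add: D_def)
  then have comp: "competition_hypergraph D = add_isolated (map_hypergraph Inl H) I"
    unfolding competition_hypergraph_def add_isolated_def map_hypergraph_def edges by simp
  let ?P = "\<lambda>k. \<exists>(I :: ('a + nat) set) D.
       finite I \<and> card I = k \<and> I \<inter> hverts (map_hypergraph Inl H) = {} \<and>
       acyclic_digraph D \<and>
       competition_hypergraph D = add_isolated (map_hypergraph Inl H) I"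
  have "?P (card I)"
    by (intro exI[of _ I] exI[of _ D] conjI finI refl disj acyc comp)
  then show ?thesis
    unfolding hypercompetition_number_def by (rule LeastI[of ?P])
qed

end

theory Submission
  imports Defs
begin

text \<open>
  Restrict an acyclic digraph realising \<open>H\<close> with extra vertices \<open>I\<close> to the vertices of \<open>H\<close>. The
  restriction is finite and acyclic, so it has a sink \<open>v\<close>: every out-neighbour of \<open>v\<close> lies
  in \<open>I\<close>. Each hyperedge through \<open>v\<close> is the in-neighbourhood of some out-neighbour of \<open>v\<close>, hence of
  some element of \<open>I\<close>, and distinct hyperedges are in-neighbourhoods of distinct vertices. So
  \<open>deg v \<le> |I|\<close>, and the minimum degree is no larger than \<open>deg v\<close>. The lemma
  \<open>ex_hdegree_le_card_isolated\<close> carries this argument.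
\<close>

lemma finite_acyclic_ex_sink_in:
  assumes "finite A" "acyclic A" "V \<noteq> {}"
  obtains v where "v \<in> V" "\<And>w. (v, w) \<in> A \<Longrightarrow> w \<notin> V"
proof -
  have "wf (A\<inverse>)" using assms by (simp add: finite_acyclic_wf_converse)
  moreover obtain x where "x \<in> V" using assms(3) by blast
  ultimately show thesis using that by (auto elim: wfE_min)
qed

text \<open>
  The vertex is a sink among \<open>hverts H\<close>, so that only \<open>I\<close> can supply the vertices whose
  in-neighbourhoods are the hyperedges through it.
\<close>

lemma ex_hdegree_le_card_isolated:
  assumes acyc: "acyclic_digraph D"
    and comp: "competition_hypergraph D = add_isolated H I"
    and fin: "finite I" and ne: "hverts H \<noteq> {}"
  shows "\<exists>v\<in>hverts H. hdegree H v \<le> card I"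
proof -
  from acyc interpret pair_fin_digraph D by (simp add: acyclic_digraph_iff_acyclic)
  have "finite (parcs D)" "acyclic (parcs D)"
    using acyc pair_finite_arcs by (auto simp: acyclic_digraph_iff_acyclic)
  then obtain v where v: "v \<in> hverts H" "\<And>w. (v, w) \<in> parcs D \<Longrightarrow> w \<notin> hverts H"
    using finite_acyclic_ex_sink_in[of "parcs D" "hverts H"] ne by blast
  have pv: "pverts D = hverts H \<union> I"
    using arg_cong[OF comp, of hverts] by (simp add: competition_hypergraph_def add_isolated_def)
  have he: "hedges H = {e. e \<subseteq> pverts D \<and> 2 \<le> card e \<and> (\<exists>w\<in>pverts D. e = in_nbhd D w)}"
    using arg_cong[OF comp, of hedges] by (simp add: competition_hypergraph_def add_isolated_def)
  have "{e \<in> hedges H. v \<in> e} \<subseteq> in_nbhd D ` I"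
  proof
    fix e assume "e \<in> {e \<in> hedges H. v \<in> e}"
    then obtain w where w: "w \<in> pverts D" "e = in_nbhd D w" "v \<in> e"
      using he by auto
    then have "(v, w) \<in> parcs D" by (simp add: in_nbhd_def)
    with v(2) w(1) pv have "w \<in> I" by blast
    with w(2) show "e \<in> in_nbhd D ` I" by blast
  qed
  then have "hdegree H v \<le> card I"
    unfolding hdegree_def by (rule surj_card_le[OF fin])
  with v(1) show ?thesis by blast
qed

lemma hdegree_map_hypergraph:
  assumes "inj f"
  shows "hdegree (map_hypergraph f H) (f v) = hdegree H v"
proof -
  have "{e \<in> hedges (map_hypergraph f H). f v \<in> e} = (`) f ` {e \<in> hedges H. v \<in> e}"
    using assms by (auto simp: map_hypergraph_def inj_image_mem_iff dest: injD)
  moreover have "inj_on ((`) f) {e \<in> hedges H. v \<in> e}"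
    using assms by (auto simp: inj_on_def inj_image_eq_iff)
  ultimately show ?thesis
    unfolding hdegree_def by (simp add: card_image)
qed

theorem theorem2p2:
  fixes H :: "'a pre_hypergraph"
  assumes "hypergraph H"
  shows "hypercompetition_number H \<ge> Min (hdegree H ` hverts H)"
proof -
  interpret hypergraph H by fact
  let ?H = "map_hypergraph (Inl :: 'a \<Rightarrow> 'a + nat) H"
  obtain I :: "('a + nat) set" and D where
    "finite I" "card I = hypercompetition_number H" "acyclic_digraph D"
    "competition_hypergraph D = add_isolated ?H I"
    using hypercompetition_number_witness[OF assms] by blast
  moreover have verts: "hverts ?H = Inl ` hverts H" by (simp add: map_hypergraph_def)
  ultimately obtain v where v: "v \<in> hverts H"
    and "hdegree ?H (Inl v) \<le> hypercompetition_number H"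
    using ex_hdegree_le_card_isolated[of D ?H I] hverts_nonempty by auto
  then have "hdegree H v \<le> hypercompetition_number H"
    by (simp add: hdegree_map_hypergraph)
  moreover have "Min (hdegree H ` hverts H) \<le> hdegree H v"
    using v finite_hverts by simp
  ultimately show ?thesis by linarith
qed

end
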